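(* Let $G_1$ and $G_2$ be finite groups with subgroups $H_1\subseteq K_1$ of $G_1$ and $H_2\subseteq K_2$ of $G_2$. If $(\psi\times\gamma,\beta)$ is an autoisoclinism between the pairs $(H_1,K_1)$ and $(H_2,K_2)$ then, for every $g\in K_1$ with $g\in S(H_1,\operatorname{Aut}(K_1))$, $$\Pr\nolimits_g(H_1,\operatorname{Aut}(K_1))=\Pr\nolimits_{\beta(g)}(H_2,\operatorname{Aut}(K_2)).$$
   Context: For subgroups $H\subseteq K$ of a finite group, $x\in K$ and $\alpha\in\operatorname{Aut}(K)$ (the automorphism group of $K$), the autocommutator is $[x,\alpha]=x^{-1}\alpha(x)$. For $g\in K$, $\Pr_g(H,\operatorname{Aut}(K)) = \frac{|\{(x,\alpha)\in H\times \operatorname{Aut}(K) : [x,\alpha]=g\}|}{|H||\operatorname{Aut}(K)|}$. $S(H,\operatorname{Aut}(K))=\{[x,\alpha]:x\in H,\alpha\in\operatorname{Aut}(K)\}$, and $[H,\operatorname{Aut}(K)]$ is the subgroup of $K$ generated by $S(H,\operatorname{Aut}(K))$. $L(H,\operatorname{Aut}(K))=\{x\in H : [x,\alpha]=1 \text{ for all } \alpha\in\operatorname{Aut}(K)\}$, a normal subgroup of $H$ contained in $H\cap Z(K)$. The map $a_{(H,\operatorname{Aut}(K))}:\frac{H}{L(H,\operatorname{Aut}(K))}\times\operatorname{Aut}(K)\to[H,\operatorname{Aut}(K)]$ is given by $(xL(H,\operatorname{Aut}(K)),\alpha)\mapsto[x,\alpha]$. An autoisoclinism between $(H_1,K_1)$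 and $(H_2,K_2)$ is a pair $(\psi\times\gamma,\beta)$ where $\psi:\frac{H_1}{L(H_1,\operatorname{Aut}(K_1))}\to\frac{H_2}{L(H_2,\operatorname{Aut}(K_2))}$, $\beta:[H_1,\operatorname{Aut}(K_1)]\to[H_2,\operatorname{Aut}(K_2)]$ and $\gamma:\operatorname{Aut}(K_1)\to\operatorname{Aut}(K_2)$ are group isomorphisms such that $a_{(H_2,\operatorname{Aut}(K_2))}\circ(\psi\times\gamma)=\beta\circ a_{(H_1,\operatorname{Aut}(K_1))}$. *)

theory Defs
  imports Complex_Main "HOL-Algebra.Bij" "HOL-Algebra.Generated_Groups"
begin

text \<open>
  Throughout, \<open>K\<close> is a group given by a record and \<open>H\<close> is (the carrier of) a subgroup of \<open>K\<close>.
  A subgroup of an ambient group \<open>G\<close> with carrier \<open>C\<close> becomes a group through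
  \<open>G\<lparr>carrier := C\<rparr>\<close>. The elements of \<open>AutoGroup K\<close> are extensional functions, so each
  automorphism of \<open>K\<close> is represented exactly once.
\<close>

definition autocommutator :: "('a, 'c) monoid_scheme \<Rightarrow> 'a \<Rightarrow> ('a \<Rightarrow> 'a) \<Rightarrow> 'a" where
  "autocommutator K x \<alpha> = inv\<^bsub>K\<^esub> x \<otimes>\<^bsub>K\<^esub> \<alpha> x"

definition autocommutator_prob :: "('a, 'c) monoid_scheme \<Rightarrow> 'a set \<Rightarrow> 'a \<Rightarrow> real" where
  "autocommutator_prob K H g =
     real (card {(x, \<alpha>). x \<in> H \<and> \<alpha> \<in> carrier (AutoGroup K) \<and> autocommutator K x \<alpha> = g})
       / (real (card H) * real (card (carrier (AutoGroup K))))"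

definition autocommutators :: "('a, 'c) monoid_scheme \<Rightarrow> 'a set \<Rightarrow> 'a set" where
  "autocommutators K H = {autocommutator K x \<alpha> |x \<alpha>. x \<in> H \<and> \<alpha> \<in> carrier (AutoGroup K)}"

definition autocommutator_subgroup ::
    "('a, 'c) monoid_scheme \<Rightarrow> 'a set \<Rightarrow> ('a, 'c) monoid_scheme" where
  "autocommutator_subgroup K H = subgroup_generated K (autocommutators K H)"

definition autocentre :: "('a, 'c) monoid_scheme \<Rightarrow> 'a set \<Rightarrow> 'a set" where
  "autocentre K H =
     {x \<in> H. \<forall>\<alpha> \<in> carrier (AutoGroup K). autocommutator K x \<alpha> = \<one>\<^bsub>K\<^esub>}"

definition autocentre_quotient :: "('a, 'c) monoid_scheme \<Rightarrow> 'a set \<Rightarrow> 'a set monoid" where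
  "autocentre_quotient K H = (K\<lparr>carrier := H\<rparr>) Mod autocentre K H"

text \<open>
  The map \<open>(x L, \<alpha>) \<mapsto> [x, \<alpha>]\<close>: on a coset of \<open>L\<close> the autocommutator with \<open>\<alpha>\<close>
  takes only one value, which \<open>the_elem\<close> extracts; see \<open>autocommutator_map_coset\<close>.
\<close>
definition autocommutator_map :: "('a, 'c) monoid_scheme \<Rightarrow> 'a set \<times> ('a \<Rightarrow> 'a) \<Rightarrow> 'a" where
  "autocommutator_map K = (\<lambda>(X, \<alpha>). the_elem ((\<lambda>x. autocommutator K x \<alpha>) ` X))"

definition autoisoclinism ::
    "('a, 'c) monoid_scheme \<Rightarrow> 'a set \<Rightarrow> ('b, 'd) monoid_scheme \<Rightarrow> 'b set \<Rightarrow>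
     ('a set \<Rightarrow> 'b set) \<Rightarrow> (('a \<Rightarrow> 'a) \<Rightarrow> ('b \<Rightarrow> 'b)) \<Rightarrow> ('a \<Rightarrow> 'b) \<Rightarrow> bool" where
  "autoisoclinism K1 H1 K2 H2 \<psi> \<gamma> \<beta> \<longleftrightarrow>
     \<psi> \<in> iso (autocentre_quotient K1 H1) (autocentre_quotient K2 H2) \<and>
     \<gamma> \<in> iso (AutoGroup K1) (AutoGroup K2) \<and>
     \<beta> \<in> iso (autocommutator_subgroup K1 H1) (autocommutator_subgroup K2 H2) \<and>
     (\<forall>p \<in> carrier (autocentre_quotient K1 H1) \<times> carrier (AutoGroup K1).
        (autocommutator_map K2 \<circ> map_prod \<psi> \<gamma>) p = (\<beta> \<circ> autocommutator_map K1) p)"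

lemma carrier_AutoGroup: "carrier (AutoGroup K) = auto K"
  by (simp add: AutoGroup_def)

lemma autocentre_iff:
  assumes "group K" and "subgroup H K"
  shows "x \<in> autocentre K H \<longleftrightarrow> x \<in> H \<and> (\<forall>\<alpha> \<in> auto K. \<alpha> x = x)"
proof -
  interpret group K by fact
  have "autocommutator K x \<alpha> = \<one>\<^bsub>K\<^esub> \<longleftrightarrow> \<alpha> x = x" if "x \<in> H" "\<alpha> \<in> auto K" for \<alpha>
  proof -
    have "x \<in> carrier K" using subgroup.mem_carrier[OF assms(2) that(1)] .
    moreover have "\<alpha> x \<in> carrier K"
      using that(2) calculation hom_in_carrier[of \<alpha> K K x] by (simp add: auto_def)
    ultimately show ?thesis
      using inv_solve_left'[of "\<one>\<^bsub>K\<^esub>" x "\<alpha> x"]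
      by (simp add: autocommutator_def)
  qed
  then show ?thesis by (auto simp: autocentre_def carrier_AutoGroup)
qed

lemma autocentre_central:
  assumes "group K" and "subgroup H K" and "x \<in> autocentre K H" and y: "y \<in> carrier K"
  shows "x \<otimes>\<^bsub>K\<^esub> y = y \<otimes>\<^bsub>K\<^esub> x"
proof -
  interpret group K by fact
  have x: "x \<in> carrier K" and fixd: "\<forall>\<alpha> \<in> auto K. \<alpha> x = x"
    using assms autocentre_iff subgroup.mem_carrier by metis+
  let ?c = "\<lambda>z \<in> carrier K. y \<otimes>\<^bsub>K\<^esub> z \<otimes>\<^bsub>K\<^esub> inv\<^bsub>K\<^esub> y"
  have cancel: "inv\<^bsub>K\<^esub> y \<otimes>\<^bsub>K\<^esub> (y \<otimes>\<^bsub>K\<^esub> a) = a" "y \<otimes>\<^bsub>K\<^esub> (inv\<^bsub>K\<^esub> y \<otimes>\<^bsub>K\<^esub> a) = a"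
    if "a \<in> carrier K" for a
    using y that by (simp_all flip: m_assoc)
  have "?c \<in> hom K K"
  proof (rule homI)
    fix a b assume "a \<in> carrier K" "b \<in> carrier K"
    then show "?c (a \<otimes>\<^bsub>K\<^esub> b) = ?c a \<otimes>\<^bsub>K\<^esub> ?c b"
      using y by (simp add: m_assoc inv_solve_left)
  qed (use y in auto)
  moreover have "bij_betw ?c (carrier K) (carrier K)"
    by (rule bij_betw_byWitness[where f' = "\<lambda>z. inv\<^bsub>K\<^esub> y \<otimes>\<^bsub>K\<^esub> z \<otimes>\<^bsub>K\<^esub> y"])
       (use y in \<open>auto simp: m_assoc cancel\<close>)
  ultimately have "?c \<in> auto K" by (simp add: auto_def Bij_def)
  then have "y \<otimes>\<^bsub>K\<^esub> x \<otimes>\<^bsub>K\<^esub> inv\<^bsub>K\<^esub> y = x" using fixd x by force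
  then show ?thesis using x y inv_solve_right'[of x "y \<otimes>\<^bsub>K\<^esub> x" y] by simp
qed

lemma autocentre_normal:
  assumes K: "group K" and H: "subgroup H K"
  shows "autocentre K H \<lhd> K\<lparr>carrier := H\<rparr>"
proof -
  interpret group K by fact
  interpret H: subgroup H K by fact
  interpret HG: group "K\<lparr>carrier := H\<rparr>" using H.subgroup_is_group[OF K] .
  have hom: "group_hom K K \<alpha>" if "\<alpha> \<in> auto K" for \<alpha>
    using that K by (auto simp: auto_def group_hom_def group_hom_axioms_def)
  have L: "subgroup (autocentre K H) K"
  proof (rule subgroup.intro)
    show "x \<otimes>\<^bsub>K\<^esub> y \<in> autocentre K H" if "x \<in> autocentre K H" "y \<in> autocentre K H" for x y
      using that unfolding autocentre_iff[OF K H]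
      by (metis H.m_closed H.mem_carrier group_hom.hom_mult[OF hom])
  qed (auto simp: autocentre_iff[OF K H] group_hom.hom_inv[OF hom] group_hom.hom_one[OF hom])
  then have "subgroup (autocentre K H) (K\<lparr>carrier := H\<rparr>)"
    using subgroup_incl[OF L H] by (auto simp: autocentre_def)
  moreover have "autocentre K H #>\<^bsub>K\<lparr>carrier := H\<rparr>\<^esub> x = x <#\<^bsub>K\<lparr>carrier := H\<rparr>\<^esub> autocentre K H"
    if "x \<in> H" for x
    using autocentre_central[OF K H _ H.mem_carrier[OF that]]
    by (simp add: r_coset_def l_coset_def)
  ultimately show ?thesis by (auto simp: normal_def normal_axioms_def HG.group_axioms)
qed

lemma autocommutator_map_coset:
  assumes K: "group K" and H: "subgroup H K" and x: "x \<in> H" and \<alpha>: "\<alpha> \<in> carrier (AutoGroup K)"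
  shows "autocommutator_map K (autocentre K H #>\<^bsub>K\<lparr>carrier := H\<rparr>\<^esub> x, \<alpha>) = autocommutator K x \<alpha>"
proof -
  interpret group K by fact
  have \<alpha>': "\<alpha> \<in> auto K" "\<alpha> \<in> hom K K" using \<alpha> by (auto simp: carrier_AutoGroup auto_def)
  have xK: "x \<in> carrier K" using subgroup.mem_carrier[OF H x] .
  have ax: "\<alpha> x \<in> carrier K" using hom_in_carrier[OF \<alpha>'(2) xK] .
  have one: "\<one>\<^bsub>K\<^esub> \<in> autocentre K H"
    using subgroup.one_closed[OF normal_imp_subgroup[OF autocentre_normal[OF K H]]] by simp
  have val: "autocommutator K (l \<otimes>\<^bsub>K\<^esub> x) \<alpha> = autocommutator K x \<alpha>" if "l \<in> autocentre K H" for l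
  proof -
    have l: "l \<in> carrier K" "\<alpha> l = l"
      using that autocentre_iff[OF K H] \<alpha>'(1) subgroup.mem_carrier[OF H] by auto
    then have "\<alpha> (l \<otimes>\<^bsub>K\<^esub> x) = l \<otimes>\<^bsub>K\<^esub> \<alpha> x" using hom_mult[OF \<alpha>'(2) l(1) xK] by simp
    then show ?thesis
      using l xK ax unfolding autocommutator_def
      by (simp add: inv_mult_group m_assoc) (metis inv_closed l_inv l_one m_assoc)
  qed
  have "(\<lambda>z. autocommutator K z \<alpha>) ` (autocentre K H #>\<^bsub>K\<lparr>carrier := H\<rparr>\<^esub> x)
          = {autocommutator K x \<alpha>}"
    using one val by (auto simp: r_coset_def image_iff)
  then show ?thesis by (simp add: autocommutator_map_def)
qed

end

theory Submission
  imports Defs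
begin

text \<open>
  The autocommutator \<open>[x, \<alpha>]\<close> only depends on the coset \<open>x L\<close>, and all cosets of \<open>L\<close> have the
  same size, so that \<open>Pr\<^sub>g\<close> is the proportion of pairs in \<open>H/L \<times> Aut K\<close> sent to \<open>g\<close> by the
  autocommutator map. The bijection \<open>\<psi> \<times> \<gamma>\<close> identifies the fibre over \<open>g\<close> with the fibre over
  \<open>\<beta> g\<close>, because \<open>\<beta>\<close> is injective.
\<close>

definition autocommutator_fibre ::
    "('a, 'c) monoid_scheme \<Rightarrow> 'a set \<Rightarrow> 'a \<Rightarrow> ('a set \<times> ('a \<Rightarrow> 'a)) set" where
  "autocommutator_fibre K H g =
     {p \<in> carrier (autocentre_quotient K H) \<times> carrier (AutoGroup K). autocommutator_map K p = g}"

text \<open>Members of \<open>auto K\<close> are extensional, so they lie in a function space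
  between finite sets. Together with finiteness of \<open>H\<close>, this makes the fibres finite,
  so their cardinalities are genuine counts.\<close>

lemma finite_auto:
  assumes "finite (carrier K)"
  shows "finite (auto K)"
proof (rule finite_subset)
  show "auto K \<subseteq> carrier K \<rightarrow>\<^sub>E carrier K"
    by (auto simp: auto_def Bij_def PiE_def hom_def)
  show "finite (carrier K \<rightarrow>\<^sub>E carrier K)"
    using assms by (simp add: finite_PiE)
qed

text \<open>Every member of a coset is a representative of it: if x lies in X = Ly, then X = Lx. The
  map can therefore be evaluated at whichever member of X is at hand.\<close>

lemma autocommutator_map_rcoset:
  assumes K: "group K" and H: "subgroup H K"
    and X: "X \<in> carrier (autocentre_quotient K H)" and x: "x \<in> X"
    and \<alpha>: "\<alpha> \<in> carrier (AutoGroup K)"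
  shows "autocommutator_map K (X, \<alpha>) = autocommutator K x \<alpha>"
proof -
  interpret HG: group "K\<lparr>carrier := H\<rparr>" using subgroup.subgroup_is_group[OF H K] .
  interpret L: normal "autocentre K H" "K\<lparr>carrier := H\<rparr>" using autocentre_normal[OF K H] .
  obtain y where y: "y \<in> H" "X = autocentre K H #>\<^bsub>K\<lparr>carrier := H\<rparr>\<^esub> y"
    using X by (auto simp: autocentre_quotient_def FactGroup_def RCOSETS_def)
  have xH: "x \<in> H"
    using HG.r_coset_subset_G[OF L.subset, of y] x y by auto
  have "X = autocentre K H #>\<^bsub>K\<lparr>carrier := H\<rparr>\<^esub> x"
    using HG.repr_independence[of x "autocentre K H" y] x y L.subgroup_axioms by simp
  then show ?thesis using autocommutator_map_coset[OF K H xH \<alpha>] by simp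
qed

text \<open>Sending (x, \<alpha>) to (Lx, \<alpha>) maps the pairs with autocommutator g onto the
  fibre over g. The preimage of a point (X, \<alpha>) consists of the pairs (x, \<alpha>) with x in
  X, so it has |L| elements.\<close>

lemma card_autocommutator_pairs:
  assumes K: "group K" and fin: "finite (carrier K)" and H: "subgroup H K"
  shows "card {(x, \<alpha>). x \<in> H \<and> \<alpha> \<in> carrier (AutoGroup K) \<and> autocommutator K x \<alpha> = g}
    = card (autocommutator_fibre K H g) * card (autocentre K H)"
    (is "card ?P = card ?A * card ?L")
proof -
  interpret HG: group "K\<lparr>carrier := H\<rparr>" using subgroup.subgroup_is_group[OF H K] .
  interpret L: normal "autocentre K H" "K\<lparr>carrier := H\<rparr>" using autocentre_normal[OF K H] .
  have Q: "carrier (autocentre_quotient K H) = rcosets\<^bsub>K\<lparr>carrier := H\<rparr>\<^esub> ?L"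
    by (simp add: autocentre_quotient_def FactGroup_def)
  have finH: "finite H" using fin subgroup.subset[OF H] finite_subset by blast
  have sub: "X \<subseteq> H" if "X \<in> carrier (autocentre_quotient K H)" for X
    using HG.rcosets_part_G[OF L.subgroup_axioms] that unfolding Q by auto
  have "finite (carrier (autocentre_quotient K H))"
    using finite_subset[of "carrier (autocentre_quotient K H)" "Pow H"] finH sub by blast
  then have "finite (carrier (autocentre_quotient K H) \<times> carrier (AutoGroup K))"
    using finite_auto[OF fin] by (simp add: carrier_AutoGroup)
  then have finA: "finite ?A"
    by (simp add: autocommutator_fibre_def)
  \<comment> \<open>The elements of \<open>Sigma ?A fst\<close> are fibre points (X, \<alpha>) with
    a marked element x of X. Forgetting X loses nothing, because distinct cosets are disjoint and x
    thus determines X.\<close>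
  have "bij_betw (\<lambda>(p, x). (x, snd p)) (Sigma ?A fst) ?P"
  proof (rule bij_betw_imageI)
    show "inj_on (\<lambda>(p, x). (x, snd p)) (Sigma ?A fst)"
    proof (rule inj_onI, clarsimp simp: autocommutator_fibre_def Q)
      fix X Y x assume "X \<in> rcosets\<^bsub>K\<lparr>carrier := H\<rparr>\<^esub> ?L" "Y \<in> rcosets\<^bsub>K\<lparr>carrier := H\<rparr>\<^esub> ?L"
        "x \<in> X" "x \<in> Y"
      then show "X = Y"
        using HG.rcos_disjoint[OF L.subgroup_axioms] by (auto simp: pairwise_def disjnt_def)
    qed
    show "(\<lambda>(p, x). (x, snd p)) ` Sigma ?A fst = ?P"
    proof (intro equalityI subsetI)
      fix z assume "z \<in> (\<lambda>(p, x). (x, snd p)) ` Sigma ?A fst"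
      then show "z \<in> ?P"
        using subsetD[OF sub] autocommutator_map_rcoset[OF K H]
        by (auto simp: autocommutator_fibre_def)
    next
      fix z assume "z \<in> ?P"
      then obtain x \<alpha> where z: "z = (x, \<alpha>)" "x \<in> H" "\<alpha> \<in> carrier (AutoGroup K)"
        "autocommutator K x \<alpha> = g" by auto
      let ?X = "?L #>\<^bsub>K\<lparr>carrier := H\<rparr>\<^esub> x"
      have "?X \<in> carrier (autocentre_quotient K H)"
        using HG.rcosetsI[OF L.subset] z by (simp add: Q)
      moreover have "x \<in> ?X" using HG.rcos_self[OF _ L.subgroup_axioms] z by simp
      ultimately have "((?X, \<alpha>), x) \<in> Sigma ?A fst"
        using z autocommutator_map_coset[OF K H] by (simp add: autocommutator_fibre_def)
      then show "z \<in> (\<lambda>(p, x). (x, snd p)) ` Sigma ?A fst"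
        using z by force
    qed
  qed
  then have "card ?P = card (Sigma ?A fst)" by (simp add: bij_betw_same_card)
  also have "\<dots> = (\<Sum>p\<in>?A. card (fst p))"
    using finA finite_subset[OF sub finH]
    by (intro card_SigmaI) (auto simp: autocommutator_fibre_def)
  also have "\<dots> = (\<Sum>p\<in>?A. card ?L)"
    using HG.card_rcosets_equal[OF _ L.subset]
    by (intro sum.cong) (auto simp: autocommutator_fibre_def Q)
  finally show ?thesis by simp
qed

text \<open>By Lagrange, |H| = |H/L| |L|, so the factor |L| from the count of pairs cancels. The
  quotient that remains involves only data that an autoisoclinism transports.\<close>

lemma autocommutator_prob_fibre:
  assumes K: "group K" and fin: "finite (carrier K)" and H: "subgroup H K"
  shows "autocommutator_prob K H g = real (card (autocommutator_fibre K H g))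
    / (real (card (carrier (autocentre_quotient K H))) * real (card (carrier (AutoGroup K))))"
proof -
  interpret HG: group "K\<lparr>carrier := H\<rparr>" using subgroup.subgroup_is_group[OF H K] .
  interpret L: normal "autocentre K H" "K\<lparr>carrier := H\<rparr>" using autocentre_normal[OF K H] .
  have "finite (autocentre K H)"
    using finite_subset[OF L.subset] finite_subset[OF subgroup.subset[OF H] fin] by simp
  \<comment> \<open>Cancelling |L| requires it to be nonzero: L is finite and contains the
    identity.\<close>
  then have "card (autocentre K H) \<noteq> 0" using L.one_closed by auto
  moreover have "card H = card (carrier (autocentre_quotient K H)) * card (autocentre K H)"
    using HG.lagrange[OF L.subgroup_axioms]
    by (simp add: order_def autocentre_quotient_def FactGroup_def)
  ultimately show ?thesis
    unfolding autocommutator_prob_def card_autocommutator_pairs[OF assms] by simp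
qed

text \<open>This passes injectivity of \<beta> from the generated subgroup to the autocommutators
  themselves.\<close>

lemma autocommutators_subset:
  assumes K: "group K" and H: "subgroup H K"
  shows "autocommutators K H \<subseteq> carrier (autocommutator_subgroup K H)"
proof -
  interpret group K by fact
  \<comment> \<open>\<open>subgroup_generated\<close> first intersects the generators with the
    carrier, so they must be shown to lie in it.\<close>
  have "autocommutators K H \<subseteq> carrier K"
    using subgroup.mem_carrier[OF H]
    by (auto simp: autocommutators_def autocommutator_def carrier_AutoGroup auto_def
        intro!: m_closed inv_closed dest: hom_in_carrier)
  then show ?thesis
    by (auto simp: autocommutator_subgroup_def carrier_subgroup_generated intro: generate.incl)
qed

lemma autocommutator_map_in_autocommutators:
  assumes K: "group K" and H: "subgroup H K"
    and "p \<in> carrier (autocentre_quotient K H) \<times> carrier (AutoGroup K)"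
  shows "autocommutator_map K p \<in> autocommutators K H"
  using assms autocommutator_map_coset[OF K H]
  by (auto simp: autocentre_quotient_def FactGroup_def RCOSETS_def autocommutators_def)

lemma card_autocommutator_fibre_autoisoclinism:
  assumes "group K1" and "subgroup H1 K1"
    and iso: "autoisoclinism K1 H1 K2 H2 \<psi> \<gamma> \<beta>" and g: "g \<in> autocommutators K1 H1"
  shows "card (autocommutator_fibre K1 H1 g) = card (autocommutator_fibre K2 H2 (\<beta> g))"
proof -
  let ?D1 = "carrier (autocentre_quotient K1 H1) \<times> carrier (AutoGroup K1)"
  let ?D2 = "carrier (autocentre_quotient K2 H2) \<times> carrier (AutoGroup K2)"
  have bij: "bij_betw (map_prod \<psi> \<gamma>) ?D1 ?D2"
    using iso by (intro bij_betw_map_prod) (auto simp: autoisoclinism_def iso_def)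
  have inj: "inj_on \<beta> (autocommutators K1 H1)"
    using iso inj_on_subset[OF _ autocommutators_subset[OF assms(1,2)]]
    by (auto simp: autoisoclinism_def iso_def bij_betw_def)
  have comm: "autocommutator_map K2 (map_prod \<psi> \<gamma> p) = \<beta> (autocommutator_map K1 p)"
    if "p \<in> ?D1" for p
    using iso that unfolding autoisoclinism_def comp_apply by blast
  \<comment> \<open>Both \<open>g\<close> and \<open>autocommutator_map K1 p\<close> are
    autocommutators, the first by hypothesis. Since \<beta> is injective on these, it reflects
    equality.\<close>
  have iff: "autocommutator_map K2 (map_prod \<psi> \<gamma> p) = \<beta> g \<longleftrightarrow> autocommutator_map K1 p = g"
    if "p \<in> ?D1" for p
    using comm[OF that] inj_on_eq_iff[OF inj _ g]
      autocommutator_map_in_autocommutators[OF assms(1,2) that] by simp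
  have "map_prod \<psi> \<gamma> ` autocommutator_fibre K1 H1 g
      = map_prod \<psi> \<gamma> ` {p \<in> ?D1. autocommutator_map K2 (map_prod \<psi> \<gamma> p) = \<beta> g}"
    unfolding autocommutator_fibre_def
    by (intro image_cong Collect_cong conj_cong refl iff[symmetric])
  \<comment> \<open>The condition now depends on p only through its image, so it can be moved to the
    image; surjectivity of \<open>map_prod \<psi> \<gamma>\<close> then gives the whole fibre over
    \<open>\<beta> g\<close>.\<close>
  also have "\<dots> = {q \<in> map_prod \<psi> \<gamma> ` ?D1. autocommutator_map K2 q = \<beta> g}"
    by (rule Compr_image_eq[symmetric])
  also have "\<dots> = autocommutator_fibre K2 H2 (\<beta> g)"
    unfolding bij_betw_imp_surj_on[OF bij] autocommutator_fibre_def ..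
  finally have "bij_betw (map_prod \<psi> \<gamma>) (autocommutator_fibre K1 H1 g)
      (autocommutator_fibre K2 H2 (\<beta> g))"
    by (intro bij_betw_subset[OF bij]) (auto simp: autocommutator_fibre_def)
  then show ?thesis by (rule bij_betw_same_card)
qed

lemma autocommutator_prob_autoisoclinism:
  assumes K1: "group K1" "finite (carrier K1)" "subgroup H1 K1"
    and K2: "group K2" "finite (carrier K2)" "subgroup H2 K2"
    and iso: "autoisoclinism K1 H1 K2 H2 \<psi> \<gamma> \<beta>" and g: "g \<in> autocommutators K1 H1"
  shows "autocommutator_prob K1 H1 g = autocommutator_prob K2 H2 (\<beta> g)"
proof -
  \<comment> \<open>The bijections \<psi> and \<gamma> make the two denominators equal.\<close>
  have "card (carrier (autocentre_quotient K1 H1)) = card (carrier (autocentre_quotient K2 H2))"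
    and "card (carrier (AutoGroup K1)) = card (carrier (AutoGroup K2))"
    using iso by (auto simp: autoisoclinism_def iso_def intro: bij_betw_same_card)
  then show ?thesis
    using card_autocommutator_fibre_autoisoclinism[OF K1(1,3) iso g]
    by (simp add: autocommutator_prob_fibre[OF K1] autocommutator_prob_fibre[OF K2])
qed

theorem theorem5p1:
  fixes G1 :: "('a, 'c) monoid_scheme" and G2 :: "('b, 'd) monoid_scheme"
    and H1 K1 :: "'a set" and H2 K2 :: "'b set"
    and \<psi> :: "'a set \<Rightarrow> 'b set" and \<gamma> :: "('a \<Rightarrow> 'a) \<Rightarrow> ('b \<Rightarrow> 'b)" and \<beta> :: "'a \<Rightarrow> 'b"
  assumes "group G1" and "finite (carrier G1)"
    and "subgroup H1 G1" and "subgroup K1 G1" and "H1 \<subseteq> K1"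
    and "group G2" and "finite (carrier G2)"
    and "subgroup H2 G2" and "subgroup K2 G2" and "H2 \<subseteq> K2"
    and "autoisoclinism (G1\<lparr>carrier := K1\<rparr>) H1 (G2\<lparr>carrier := K2\<rparr>) H2 \<psi> \<gamma> \<beta>"
  shows "\<forall>g \<in> K1. g \<in> autocommutators (G1\<lparr>carrier := K1\<rparr>) H1 \<longrightarrow>
    autocommutator_prob (G1\<lparr>carrier := K1\<rparr>) H1 g
      = autocommutator_prob (G2\<lparr>carrier := K2\<rparr>) H2 (\<beta> g)"
proof (intro ballI impI)
  fix g assume "g \<in> autocommutators (G1\<lparr>carrier := K1\<rparr>) H1"
  moreover have "group (G1\<lparr>carrier := K1\<rparr>)" "group (G2\<lparr>carrier := K2\<rparr>)"
    using assms subgroup.subgroup_is_group by auto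
  moreover have "subgroup H1 (G1\<lparr>carrier := K1\<rparr>)" "subgroup H2 (G2\<lparr>carrier := K2\<rparr>)"
    using group.subgroup_incl[of G1 H1 K1] group.subgroup_incl[of G2 H2 K2] assms by simp_all
  moreover have "finite (carrier (G1\<lparr>carrier := K1\<rparr>))" "finite (carrier (G2\<lparr>carrier := K2\<rparr>))"
    using assms finite_subset[OF subgroup.subset] by simp_all
  ultimately show "autocommutator_prob (G1\<lparr>carrier := K1\<rparr>) H1 g
      = autocommutator_prob (G2\<lparr>carrier := K2\<rparr>) H2 (\<beta> g)"
    using assms by (intro autocommutator_prob_autoisoclinism) auto
qed

end
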